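(* Let $m,k\ge 1$ be integers. Under the scaled Rayleigh model with prior $\pi_1(\sigma)\propto 1/\sigma$, put $\delta(\mathbf{x})=\sum_{i=1}^d x_i^2+(n-d)T_0^2$. The Bayes point predictors of $U_{m(k)}$ given $\mathbf{x}$ under squared error loss (the predictive mean $E(U_{m(k)}|\mathbf{x})$), absolute error loss (the predictive median) and zero-one loss (the predictive mode) are, respectively, $$\widehat{U}_{m(k)}=\frac{B(d-\frac12,\,m+\frac12)}{B(d,m)}\sqrt{\frac{\delta(\mathbf{x})}{k}},$$ $$\hat{U}^*_{m(k)}=\sqrt{\frac{(1-\mathrm{Med}(d,m))\,\delta(\mathbf{x})}{k\,\mathrm{Med}(d,m)}},$$ $$\widetilde{U}_{m(k)}=\sqrt{\frac{(2m-1)\,\delta(\mathbf{x})}{k(2d+1)}},$$ where $\mathrm{Med}(d,m)$ denotes the median of the $Beta(d,m)$ distribution.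
   Context: Model. $n$ iid component lifetimes have density $f(x;\sigma)=\frac{x}{\sigma}\exp\{-x^2/(2\sigma)\}$, $x>0$ (scaled Rayleigh distribution, $\sigma>0$ unknown). They are observed under Type-I hybrid censoring with pre-fixed integer $1\le r\le n$ and time $T>0$: the test stops at $T_0=\min\{x_{r:n},T\}$, where $x_{1:n}<\cdots<x_{n:n}$ are the ordered lifetimes; $d=\max\{s: s\le r,\ x_{s:n}\le T\}$, assumed to satisfy $d\ge 1$; and the observed sample is $\mathbf{x}=(x_1,\ldots,x_d)=(x_{1:n},\ldots,x_{d:n})$. Thus $0<x_1<\cdots<x_d\le T_0$, and $T_0=x_d$ if $d=r$ while $T_0=T$ if $d<r$. The likelihood is $$L(\sigma|\mathbf{x})\propto \sigma^{-d}\Big[\prod_{i=1}^d x_i\Big]\exp\Big\{-\frac{1}{2\sigma}\Big[\sum_{i=1}^d x_i^2+(n-d)T_0^2\Big]\Big\}.$$ Posterior. $\pi_1^*(\sigma|\mathbf{x})$ is the probability density on $(0,\infty)$ proportional to $L(\sigma|\mathbf{x})\cdot\frac1\sigma$. Repair times. $U_{m(k)}$ is the $m$-th minimal repair time of a series system of $k$ independent identical components with the same lifetime distribution, independent of the sample given $\sigma$; its density given $\sigma$ is $$f_{U_{m(k)}}(u|\sigma)=\frac{k^m u^{2m-1}}{\Gamma(m)\sigma^m 2^{m-1}}\exp\Big\{-\frac{k u^2}{2\sigma}\Big\},\qquad u>0.$$ Mean, median and mode are those of the predictive distribution with density $f^*_{U_{m(k)}}(u|\mathbf{x})=\int_0^\infty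 f_{U_{m(k)}}(u|\sigma)\pi_1^*(\sigma|\mathbf{x})\,d\sigma$, $u>0$. $B(\cdot,\cdot)$ is the complete beta function. *)

theory Defs
  imports "HOL-Probability.Probability"
begin

text \<open>
  Throughout, \<open>x i\<close> for \<open>1 \<le> i \<le> n\<close> is the \<open>i\<close>-th ordered lifetime $x_{i:n}$ of the complete
  experiment; values of \<open>x\<close> outside \<open>{1..n}\<close> are irrelevant.
  The inserted \<open>0\<close> is the value of $d$ when no failure is observed.
\<close>

definition observed_failures :: "nat \<Rightarrow> real \<Rightarrow> (nat \<Rightarrow> real) \<Rightarrow> nat" where
  "observed_failures r T x = Max (insert 0 {s. 1 \<le> s \<and> s \<le> r \<and> x s \<le> T})"

definition termination_time :: "nat \<Rightarrow> real \<Rightarrow> (nat \<Rightarrow> real) \<Rightarrow> real" where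
  "termination_time r T x = min (x r) T"

definition delta :: "nat \<Rightarrow> nat \<Rightarrow> real \<Rightarrow> (nat \<Rightarrow> real) \<Rightarrow> real" where
  "delta n d T0 x = (\<Sum>i=1..d. (x i)\<^sup>2) + (real n - real d) * T0\<^sup>2"

definition rayleigh_density :: "real \<Rightarrow> real \<Rightarrow> real" where
  "rayleigh_density \<sigma> t = (if t > 0 then t / \<sigma> * exp (- t\<^sup>2 / (2 * \<sigma>)) else 0)"

definition likelihood_kernel :: "nat \<Rightarrow> nat \<Rightarrow> real \<Rightarrow> (nat \<Rightarrow> real) \<Rightarrow> real \<Rightarrow> real" where
  "likelihood_kernel n d T0 x \<sigma> =
     1 / \<sigma> ^ d * (\<Prod>i=1..d. x i)
       * exp (- 1 / (2 * \<sigma>) * ((\<Sum>i=1..d. (x i)\<^sup>2) + (real n - real d) * T0\<^sup>2))"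

text \<open>\<open>L\<close> is a likelihood: it agrees with the kernel up to a positive factor free of \<open>\<sigma>\<close>.\<close>

definition is_likelihood ::
    "nat \<Rightarrow> nat \<Rightarrow> real \<Rightarrow> (nat \<Rightarrow> real) \<Rightarrow> (real \<Rightarrow> real) \<Rightarrow> bool" where
  "is_likelihood n d T0 x L \<longleftrightarrow>
     (\<exists>c>0. \<forall>\<sigma>>0. L \<sigma> = c * likelihood_kernel n d T0 x \<sigma>)"

lemma rayleigh_survival:
  assumes \<sigma>: "\<sigma> > 0" and t: "t \<ge> 0"
  shows "measure (density lborel (\<lambda>s. ennreal (rayleigh_density \<sigma> s))) {t..}
           = exp (- t\<^sup>2 / (2 * \<sigma>))"
proof -
  let ?f = "\<lambda>s. s / \<sigma> * exp (- s\<^sup>2 / (2 * \<sigma>))"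
  have meas: "(\<lambda>s. ennreal (rayleigh_density \<sigma> s)) \<in> borel_measurable lborel"
    unfolding rayleigh_density_def by measurable
  have "emeasure (density lborel (\<lambda>s. ennreal (rayleigh_density \<sigma> s))) {t..}
      = (\<integral>\<^sup>+s. ennreal (rayleigh_density \<sigma> s) * indicator {t..} s \<partial>lborel)"
    using meas by (subst emeasure_density) auto
  also have "\<dots> = (\<integral>\<^sup>+s. ennreal (?f s) * indicator {t..} s \<partial>lborel)"
    using t by (intro nn_integral_cong)
      (force simp: rayleigh_density_def order_less_le split: split_indicator)
  also have "\<dots> = ennreal (0 - (- exp (- t\<^sup>2 / (2 * \<sigma>))))"
  proof (rule nn_integral_FTC_atLeast)
    show "?f \<in> borel_measurable borel" by measurable
    show "((\<lambda>s. - exp (- s\<^sup>2 / (2 * \<sigma>))) has_real_derivative ?f s) (at s)" for s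
      using \<sigma> by (auto intro!: derivative_eq_intros simp: field_simps)
    show "0 \<le> ?f s" if "t \<le> s" for s using that t \<sigma> by simp
    have "filterlim (\<lambda>s. s\<^sup>2 / (2 * \<sigma>)) at_top (at_top :: real filter)"
      using \<sigma>
      by (intro filterlim_at_top_mult_tendsto_pos[OF tendsto_const, where c = "1 / (2 * \<sigma>)", simplified]
            filterlim_pow_at_top filterlim_ident) simp_all
    hence "filterlim (\<lambda>s. - s\<^sup>2 / (2 * \<sigma>)) at_bot (at_top :: real filter)"
      by (simp add: filterlim_uminus_at_bot)
    from tendsto_minus[OF filterlim_compose[OF exp_at_bot this]]
    show "((\<lambda>s. - exp (- s\<^sup>2 / (2 * \<sigma>))) \<longlongrightarrow> 0) at_top" by simp
  qed
  finally show ?thesis by (simp add: measure_def)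
qed

lemma is_likelihood_joint_density:
  assumes "d \<le> n" and "T0 \<ge> 0" and "\<And>i. 1 \<le> i \<Longrightarrow> i \<le> d \<Longrightarrow> x i > 0"
  shows "is_likelihood n d T0 x
     (\<lambda>\<sigma>. fact n / fact (n - d) * (\<Prod>i=1..d. rayleigh_density \<sigma> (x i))
        * measure (density lborel (\<lambda>s. ennreal (rayleigh_density \<sigma> s))) {T0..} ^ (n - d))"
  unfolding is_likelihood_def
proof (intro exI[of _ "fact n / fact (n - d)"] conjI allI impI)
  fix \<sigma> :: real assume \<sigma>: "\<sigma> > 0"
  have "(\<Prod>i=1..d. rayleigh_density \<sigma> (x i))
      = (\<Prod>i=1..d. x i * (1 / \<sigma>) * exp (- (x i)\<^sup>2 / (2 * \<sigma>)))"
    using assms(3) by (intro prod.cong) (auto simp: rayleigh_density_def)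
  also have "\<dots> = (\<Prod>i=1..d. x i) * (1 / \<sigma>) ^ d * exp (\<Sum>i=1..d. - (x i)\<^sup>2 / (2 * \<sigma>))"
    by (simp only: prod.distrib exp_sum finite_atLeastAtMost) simp
  finally have p: "(\<Prod>i=1..d. rayleigh_density \<sigma> (x i)) =
      (\<Prod>i=1..d. x i) * (1 / \<sigma>) ^ d * exp (\<Sum>i=1..d. - (x i)\<^sup>2 / (2 * \<sigma>))" .
  have s: "measure (density lborel (\<lambda>s. ennreal (rayleigh_density \<sigma> s))) {T0..} ^ (n - d)
      = exp ((real n - real d) * (- T0\<^sup>2 / (2 * \<sigma>)))"
    using assms(1,2) \<sigma> by (simp add: rayleigh_survival exp_of_nat_mult[symmetric] of_nat_diff)
  have e: "exp (\<Sum>i=1..d. - (x i)\<^sup>2 / (2 * \<sigma>)) * exp ((real n - real d) * (- T0\<^sup>2 / (2 * \<sigma>)))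
      = exp (- 1 / (2 * \<sigma>) * ((\<Sum>i=1..d. (x i)\<^sup>2) + (real n - real d) * T0\<^sup>2))"
    by (simp add: exp_add[symmetric] sum_negf sum_divide_distrib[symmetric] field_simps
        add_divide_distrib[symmetric])
  show "fact n / fact (n - d) * (\<Prod>i=1..d. rayleigh_density \<sigma> (x i))
        * measure (density lborel (\<lambda>s. ennreal (rayleigh_density \<sigma> s))) {T0..} ^ (n - d)
      = fact n / fact (n - d) * likelihood_kernel n d T0 x \<sigma>"
    unfolding p s likelihood_kernel_def e[symmetric] by (simp add: power_one_over)
qed simp

definition posterior_density :: "(real \<Rightarrow> real) \<Rightarrow> real \<Rightarrow> real" where
  "posterior_density L \<sigma> = L \<sigma> * (1 / \<sigma>) / (LINT s:{0<..}|lborel. L s * (1 / s))"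

definition repair_density :: "nat \<Rightarrow> nat \<Rightarrow> real \<Rightarrow> real \<Rightarrow> real" where
  "repair_density m k \<sigma> u =
     real k ^ m * u ^ (2 * m - 1) / (Gamma (real m) * \<sigma> ^ m * 2 ^ (m - 1))
       * exp (- (real k * u\<^sup>2) / (2 * \<sigma>))"

definition predictive_density :: "nat \<Rightarrow> nat \<Rightarrow> (real \<Rightarrow> real) \<Rightarrow> real \<Rightarrow> real" where
  "predictive_density m k L u =
     (if u > 0 then LINT \<sigma>:{0<..}|lborel. repair_density m k \<sigma> u * posterior_density L \<sigma> else 0)"

definition predictive_distribution :: "nat \<Rightarrow> nat \<Rightarrow> (real \<Rightarrow> real) \<Rightarrow> real measure" where
  "predictive_distribution m k L = density lborel (\<lambda>u. ennreal (predictive_density m k L u))"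

definition is_median :: "real measure \<Rightarrow> real \<Rightarrow> bool" where
  "is_median M v \<longleftrightarrow> measure M {..v} \<ge> 1 / 2 \<and> measure M {v..} \<ge> 1 / 2"

definition median :: "real measure \<Rightarrow> real" where
  "median M = (THE v. is_median M v)"

definition beta_density :: "real \<Rightarrow> real \<Rightarrow> real \<Rightarrow> real" where
  "beta_density a b t =
     (if 0 < t \<and> t < 1 then t powr (a - 1) * (1 - t) powr (b - 1) / Beta a b else 0)"

definition beta_distribution :: "real \<Rightarrow> real \<Rightarrow> real measure" where
  "beta_distribution a b = density lborel (\<lambda>t. ennreal (beta_density a b t))"

definition Med :: "real \<Rightarrow> real \<Rightarrow> real" where
  "Med a b = median (beta_distribution a b)"

end

theory Submission
  imports Defs
begin

text \<open>
  Write \<open>\<delta>\<close> for \<open>delta n d T0 x\<close>, which is positive because at least one failure is observed. The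
  likelihood is a constant times \<open>\<sigma>\<close> to the power \<open>- d\<close> times \<open>exp (- \<delta> / (2 * \<sigma>))\<close>, so with the prior
  \<open>1 / \<sigma>\<close> the posterior is the inverse gamma distribution with shape \<open>d\<close> and scale \<open>\<delta> / 2\<close>. The
  repair density has the same shape in \<open>\<sigma>\<close>, so that both the normalising constant and the mixture
  over \<open>\<sigma>\<close> are values of one integral (\<open>inverse_gamma_integral\<close>), and the predictive density at
  \<open>u > 0\<close> is proportional to \<open>u ^ (2 * m - 1) / (\<delta> + k * u\<^sup>2) ^ (d + m)\<close>
  (\<open>predictive_density_closed_form\<close>).

  The substitution \<open>t = \<delta> / (\<delta> + k * u\<^sup>2)\<close> turns this density into that of the \<open>Beta(d, m)\<close>
  distribution: the predictive distribution is the law of \<open>sqrt (\<delta> * (1 - t) / (k * t))\<close> for a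
  \<open>Beta(d, m)\<close> variable \<open>t\<close> (\<open>predictive_distribution_eq_distr\<close>). The mean is therefore a Beta
  integral in which the square root moves the parameters to \<open>d - 1/2\<close> and \<open>m + 1/2\<close>. The
  transformation is strictly decreasing, so it exchanges the two tails in the definition of a median
  and maps the unique median of \<open>Beta(d, m)\<close> to the unique predictive median. The mode is read off the
  closed form; that the maximum is strict and global is the strict concavity of the logarithm, in
  the form of the weighted inequality between arithmetic and geometric means
  (\<open>power_over_quadratic_less_max\<close>).
\<close>

section \<open>Change of variables\<close>

text \<open>
  For a nonnegative function the Henstock-Kurzweil integral is absolute, so the change of variables
  for absolutely integrable functions needs no integrability condition beyond the existence of one of
  the two integrals.
\<close>

lemma has_integral_change_of_variables_nonneg:
  fixes f g g' :: "real \<Rightarrow> real"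
  assumes S: "S \<in> sets borel"
    and deriv: "\<And>x. x \<in> S \<Longrightarrow> (g has_field_derivative g' x) (at x within S)"
    and inj: "inj_on g S"
    and nonneg: "\<And>t. t \<in> g ` S \<Longrightarrow> 0 \<le> f t"
  shows "((\<lambda>x. \<bar>g' x\<bar> * f (g x)) has_integral I) S \<longleftrightarrow> (f has_integral I) (g ` S)"
proof -
  have *: "(F has_integral I) A \<longleftrightarrow> F absolutely_integrable_on A \<and> integral A F = I"
    if "\<And>x. x \<in> A \<Longrightarrow> 0 \<le> F x" for A and F :: "real \<Rightarrow> real"
    using that nonnegative_absolutely_integrable_1[of F A]
      set_lebesgue_integral_eq_integral(1)[of A F]
    by (auto simp: has_integral_iff)
  have "S \<in> sets lebesgue" using S by auto
  from has_absolute_integral_change_of_variables_1'[OF this deriv inj, of f I] show ?thesis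
    using nonneg by (subst (1 2) *) auto
qed

lemma has_bochner_integral_lborel_nonneg:
  fixes f :: "real \<Rightarrow> real"
  assumes f: "f \<in> borel_measurable borel" and S: "S \<in> sets borel"
    and nonneg: "\<And>x. x \<in> S \<Longrightarrow> 0 \<le> f x" and int: "(f has_integral I) S"
  shows "has_bochner_integral lborel (\<lambda>x. indicator S x * f x) I"
proof (rule has_bochner_integral_nn_integral)
  show "(\<lambda>x. indicator S x * f x) \<in> borel_measurable lborel"
    using f S by simp
  show "AE x in lborel. 0 \<le> indicator S x * f x"
    using nonneg by (auto split: split_indicator)
  show "0 \<le> I" using int nonneg by (rule has_integral_nonneg)
  show "(\<integral>\<^sup>+x. ennreal (indicator S x * f x) \<partial>lborel) = ennreal I"
    by (rule nn_integral_has_integral_lebesgue[OF nonneg int])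
qed

text \<open>
  The change of variables for densities. The map \<open>h\<close> carries one density to the other, but the
  computation uses its inverse \<open>g\<close>: the mass that the image measure gives to \<open>A\<close> is the integral of
  \<open>f\<close> times the indicator of \<open>h -` A\<close>, and substituting \<open>t = g u\<close> turns that indicator into the
  indicator of \<open>A\<close>.
\<close>

lemma density_lborel_eq_distr:
  fixes f g g' h p :: "real \<Rightarrow> real"
  assumes S: "S \<in> sets borel"
    and deriv: "\<And>u. u \<in> S \<Longrightarrow> (g has_field_derivative g' u) (at u within S)"
    and left_inv: "\<And>u. u \<in> S \<Longrightarrow> h (g u) = u"
    and h: "h \<in> borel_measurable borel"
    and f: "integrable lborel f" "\<And>t. 0 \<le> f t" "\<And>t. t \<notin> g ` S \<Longrightarrow> f t = 0"
    and p: "p \<in> borel_measurable borel" "\<And>u. u \<in> S \<Longrightarrow> p u = \<bar>g' u\<bar> * f (g u)"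
      "\<And>u. u \<notin> S \<Longrightarrow> p u = 0"
  shows "density lborel p = distr (density lborel f) borel h"
proof (rule measure_eqI)
  fix A assume "A \<in> sets (density lborel (\<lambda>u. ennreal (p u)))"
  then have A: "A \<in> sets borel" by simp
  have fm [measurable]: "f \<in> borel_measurable borel" using f(1) by auto
  note h [measurable] p(1) [measurable] A [measurable]
  have hA [measurable]: "h -` A \<in> sets borel" using measurable_sets[OF h A] by simp
  define F where "F t = f t * indicator (h -` A) t" for t
  define J where "J = integral\<^sup>L lborel F"
  have F: "integrable lborel F" unfolding F_def
    using f(1) hA by (intro integrable_real_mult_indicator) auto
  have Fm [measurable]: "F \<in> borel_measurable borel" using F by auto
  have F0: "0 \<le> F t" for t using f(2) by (simp add: F_def)
  have "(F has_integral J) UNIV" unfolding J_def by (rule has_integral_integral_lborel[OF F])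
  then have "((\<lambda>t. if t \<in> g ` S then F t else 0) has_integral J) UNIV"
    by (rule has_integral_eq[rotated]) (auto simp: F_def f(3))
  then have "(F has_integral J) (g ` S)" by (simp only: has_integral_restrict_UNIV)
  moreover have "inj_on g S" by (rule inj_on_inverseI[of _ h]) (rule left_inv)
  ultimately have "((\<lambda>u. \<bar>g' u\<bar> * F (g u)) has_integral J) S"
    by (subst has_integral_change_of_variables_nonneg[OF S deriv]) (auto simp: F0)
  then have "((\<lambda>u. p u * indicator A u) has_integral J) S"
    by (rule has_integral_eq[rotated]) (auto simp: F_def p left_inv split: split_indicator)
  then have "((\<lambda>u. if u \<in> S then p u * indicator A u else 0) has_integral J) UNIV"
    by (simp only: has_integral_restrict_UNIV)
  then have "((\<lambda>u. p u * indicator A u) has_integral J) UNIV"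
    by (rule has_integral_eq[rotated]) (auto simp: p)
  moreover have p0: "0 \<le> p u" for u by (cases "u \<in> S") (auto simp: p f)
  ultimately have "(\<integral>\<^sup>+u. ennreal (p u * indicator A u) \<partial>lborel) = ennreal J"
    by (intro nn_integral_has_integral_lborel) auto
  moreover have "(\<integral>\<^sup>+t. ennreal (F t) \<partial>lborel) = ennreal J"
    unfolding J_def by (rule nn_integral_eq_integral[OF F]) (simp add: F0)
  ultimately show "emeasure (density lborel p) A = emeasure (distr (density lborel f) borel h) A"
    by (simp add: emeasure_density emeasure_distr F_def ennreal_mult' p0 f(2) ennreal_indicator)
qed simp

text \<open>
  The substitution \<open>t = b / s\<close> in Euler's integral for \<open>Gamma a\<close>.
\<close>

lemma inverse_gamma_integral:
  fixes b :: real
  assumes b: "b > 0" and a: "a \<ge> 1"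
  shows "(LINT s:{0<..}|lborel. exp (- b / s) / s ^ (a + 1)) = Gamma (real a) / b ^ a"
proof -
  let ?g = "\<lambda>s::real. b / s" and ?f = "\<lambda>t::real. t powr (real a - 1) / exp t"
  have img: "?g ` {0<..} = {0<..}"
  proof (intro equalityI subsetI)
    fix t :: real assume "t \<in> {0<..}"
    then have "t = ?g (b / t)" "b / t \<in> {0<..}" using b by auto
    then show "t \<in> ?g ` {0<..}" by blast
  qed (use b in auto)
  have "(?f has_integral Gamma (real a)) {0<..}"
    using Gamma_integral_real[of "real a"] a
    by (subst has_integral_spike_set_eq[of _ "{0..}"])
       (auto intro!: negligible_subset[OF negligible_sing[of "0::real"]])
  then have "((\<lambda>s. \<bar>- b / s\<^sup>2\<bar> * ?f (?g s)) has_integral Gamma (real a)) {0<..}"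
    by (subst has_integral_change_of_variables_nonneg)
       (use b in \<open>auto simp: img inj_on_def power2_eq_square intro!: derivative_eq_intros\<close>)
  then have "((\<lambda>s. b ^ a * (exp (- b / s) / s ^ (a + 1))) has_integral Gamma (real a)) {0<..}"
  proof (rule has_integral_eq[rotated])
    fix s :: real assume s: "s \<in> {0<..}"
    obtain c where c: "a = Suc c" using a by (cases a) auto
    show "\<bar>- b / s\<^sup>2\<bar> * ?f (?g s) = b ^ a * (exp (- b / s) / s ^ (a + 1))"
      using s b by (simp add: c powr_realpow exp_minus power_divide field_simps power2_eq_square)
  qed
  then have "has_bochner_integral lborel
      (\<lambda>s. indicator {0<..} s * (b ^ a * (exp (- b / s) / s ^ (a + 1)))) (Gamma (real a))"
    by (intro has_bochner_integral_lborel_nonneg) (use b in auto)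
  then have "has_bochner_integral lborel
      (\<lambda>s. 1 / b ^ a * (indicator {0<..} s * (b ^ a * (exp (- b / s) / s ^ (a + 1)))))
      (1 / b ^ a * Gamma (real a))"
    by (rule has_bochner_integral_mult_right)
  from has_bochner_integral_integral_eq[OF this] b show ?thesis
    by (simp add: set_lebesgue_integral_def)
qed

section \<open>The Beta distribution\<close>

lemma has_bochner_integral_Beta:
  fixes a b :: real
  assumes "a > 0" "b > 0"
  shows "has_bochner_integral lborel
    (\<lambda>t. indicator {0<..<1} t * (t powr (a - 1) * (1 - t) powr (b - 1))) (Beta a b)"
  using has_integral_Beta_real[OF assms]
  by (intro has_bochner_integral_lborel_nonneg) (auto simp: has_integral_Icc_iff_Ioo)

lemma Beta_pos_real: "a > 0 \<Longrightarrow> b > 0 \<Longrightarrow> Beta a b > (0::real)"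
  by (simp add: Beta_def Gamma_real_pos)

lemma borel_measurable_beta_density [measurable]: "beta_density a b \<in> borel_measurable borel"
  unfolding beta_density_def by measurable

lemma beta_density_nonneg: "a > 0 \<Longrightarrow> b > 0 \<Longrightarrow> 0 \<le> beta_density a b t"
  using Beta_pos_real[of a b] by (auto simp: beta_density_def)

lemma has_bochner_integral_beta_density:
  assumes "a > 0" "b > 0"
  shows "has_bochner_integral lborel (beta_density a b) 1"
proof -
  have "has_bochner_integral lborel
    (\<lambda>t. 1 / Beta a b * (indicator {0<..<1} t * (t powr (a - 1) * (1 - t) powr (b - 1))))
    (1 / Beta a b * Beta a b)"
    by (rule has_bochner_integral_mult_right) (rule has_bochner_integral_Beta[OF assms])
  also have "(\<lambda>t. 1 / Beta a b * (indicator {0<..<1} t * (t powr (a - 1) * (1 - t) powr (b - 1))))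
      = beta_density a b"
    by (auto simp: beta_density_def fun_eq_iff split: split_indicator)
  finally show ?thesis using Beta_pos_real[OF assms] by simp
qed

lemma real_distribution_beta:
  assumes "a > 0" "b > 0"
  shows "real_distribution (beta_distribution a b)"
proof -
  have "(\<integral>\<^sup>+t. ennreal (beta_density a b t) \<partial>lborel) = 1"
    using nn_integral_eq_integral[of lborel "beta_density a b"]
      has_bochner_integral_beta_density[OF assms] beta_density_nonneg[OF assms]
    by (simp add: has_bochner_integral_iff)
  then have "prob_space (beta_distribution a b)"
    unfolding beta_distribution_def by (intro prob_spaceI) (simp add: emeasure_density)
  then show ?thesis
    by (simp add: real_distribution_def real_distribution_axioms_def beta_distribution_def)
qed

section \<open>Medians\<close>

text \<open>
  A median exists by the intermediate value theorem, as the distribution function of a measure without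
  atoms is continuous. If \<open>p < q\<close> were two medians, \<open>{..p}\<close> and \<open>{q..}\<close> would already exhaust the
  total mass, leaving none for the interval between them.
\<close>

lemma ex1_is_median:
  fixes M :: "real measure"
  assumes "real_distribution M" and ab: "a < b"
    and supp: "measure M {..a} = 0" "measure M {b..} = 0"
    and no_atoms: "\<And>t. measure M {t} = 0"
    and gaps: "\<And>p q. a \<le> p \<Longrightarrow> p < q \<Longrightarrow> q \<le> b \<Longrightarrow> measure M {p<..<q} > 0"
  shows "\<exists>!v. is_median M v" and "is_median M v \<Longrightarrow> a < v \<and> v < b"
proof -
  interpret real_distribution M by fact
  have inside: "a < v \<and> v < b" if "is_median M v" for v
  proof (rule ccontr)
    assume "\<not> (a < v \<and> v < b)"
    then have "{..v} \<subseteq> {..a} \<or> {v..} \<subseteq> {b..}" by auto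
    then have "measure M {..v} \<le> 0 \<or> measure M {v..} \<le> 0"
      using finite_measure_mono[of "{..v}" "{..a}"] finite_measure_mono[of "{v..}" "{b..}"] supp
      by auto
    with that show False by (auto simp: is_median_def)
  qed
  then show "is_median M v \<Longrightarrow> a < v \<and> v < b" .
  have uniq: False if pq: "is_median M p" "is_median M q" "p < q" for p q
  proof -
    have "measure M ({..p} \<union> {p<..<q} \<union> {q..}) = measure M {..p} + measure M {p<..<q} + measure M {q..}"
      using \<open>p < q\<close> by (subst finite_measure_Union; (auto simp: finite_measure_Union)?)+
    moreover have "measure M {p<..<q} > 0"
      using inside[OF pq(1)] inside[OF pq(2)] pq(3) by (intro gaps) auto
    ultimately show False
      using pq prob_le_1[of "{..p} \<union> {p<..<q} \<union> {q..}"] by (auto simp: is_median_def)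
  qed
  \<comment> \<open>Without atoms both tail conditions are conditions on the distribution function alone.\<close>
  have compl: "measure M {t..} = 1 - measure M {..t}" for t
  proof -
    have "measure M {t..} = measure M ({t} \<union> {t<..})" by (rule arg_cong[where f = "measure M"]) auto
    also have "\<dots> = measure M {t<..}"
      using no_atoms[of t] by (subst finite_measure_Union) auto
    also have "{t<..} = space M - {..t}" by auto
    finally show ?thesis by (simp add: prob_compl del: space_eq_univ)
  qed
  have "\<exists>v. a \<le> v \<and> v \<le> b \<and> cdf M v = 1/2"
  proof (rule IVT)
    show "cdf M a \<le> 1/2" using supp by (simp add: cdf_def)
    show "1/2 \<le> cdf M b" using supp compl[of b] by (simp add: cdf_def)
    show "\<forall>t. a \<le> t \<and> t \<le> b \<longrightarrow> isCont (cdf M) t"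
      using finite_borel_measure.isCont_cdf[OF finite_borel_measure_M] no_atoms by auto
  qed (use ab in simp)
  then obtain v where "cdf M v = 1/2" by blast
  then have "is_median M v" by (simp add: is_median_def compl cdf_def)
  then show "\<exists>!v. is_median M v"
    using uniq by (metis linorder_neqE)
qed

text \<open>
  The hypotheses of \<open>ex1_is_median\<close> for the Beta distribution on the unit interval. Each is a
  statement about when an event is null, and an event is null exactly if the density vanishes almost
  everywhere on it.
\<close>

lemma measure_beta_distribution:
  assumes "a > 0" "b > 0"
  shows "measure (beta_distribution a b) {..0} = 0"
    and "measure (beta_distribution a b) {1..} = 0"
    and "measure (beta_distribution a b) {t} = 0"
    and "0 \<le> p \<Longrightarrow> p < q \<Longrightarrow> q \<le> 1 \<Longrightarrow> measure (beta_distribution a b) {p<..<q} > 0"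
proof -
  interpret real_distribution "beta_distribution a b"
    by (rule real_distribution_beta[OF assms])
  have density_0: "ennreal (beta_density a b t) = 0 \<longleftrightarrow> beta_density a b t = 0" for t
    using beta_density_nonneg[OF assms, of t] by (auto simp: ennreal_eq_0_iff)
  have null: "measure (beta_distribution a b) A = 0 \<longleftrightarrow>
      (AE t in lborel. t \<in> A \<longrightarrow> beta_density a b t = 0)" if "A \<in> sets borel" for A
  proof -
    have "measure (beta_distribution a b) A = 0 \<longleftrightarrow> A \<in> null_sets (beta_distribution a b)"
      using that by (auto simp: null_sets_def emeasure_eq_measure)
    also have "\<dots> \<longleftrightarrow> (AE t in lborel. t \<in> A \<longrightarrow> beta_density a b t = 0)"
      using that by (simp add: beta_distribution_def null_sets_density_iff density_0)
    finally show ?thesis .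
  qed
  show "measure (beta_distribution a b) {..0} = 0" "measure (beta_distribution a b) {1..} = 0"
    by (simp_all add: null beta_density_def)
  show "measure (beta_distribution a b) {t} = 0"
    using AE_lborel_singleton[of t]
    by (subst null, simp) (rule AE_mp, assumption, auto)
  assume pq: "0 \<le> p" "p < q" "q \<le> 1"
  have "measure (beta_distribution a b) {p<..<q} \<noteq> 0"
  proof
    assume "measure (beta_distribution a b) {p<..<q} = 0"
    then have zero: "AE t in lborel. t \<in> {p<..<q} \<longrightarrow> beta_density a b t = 0"
      by (simp only: null borel_open open_greaterThanLessThan)
    have nonzero: "beta_density a b t \<noteq> 0" if "t \<in> {p<..<q}" for t
      using that pq Beta_pos_real[OF assms] by (simp add: beta_density_def)
    have "AE t in lborel. t \<notin> {p<..<q}"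
      using zero by eventually_elim (use nonzero in blast)
    then have "{p<..<q} \<in> null_sets lborel" by (subst (asm) AE_iff_null_sets[symmetric]) auto
    then show False using pq by (simp add: null_sets_def)
  qed
  then show "measure (beta_distribution a b) {p<..<q} > 0"
    by (simp add: zero_less_measure_iff)
qed

text \<open>
  \<open>Med\<close> is a definite description, so nothing can be said about it before the median is known to exist
  and to be unique.
\<close>

lemma is_median_beta_iff:
  assumes "a > 0" "b > 0"
  shows "is_median (beta_distribution a b) v \<longleftrightarrow> v = Med a b"
    and "0 < Med a b" and "Med a b < 1"
proof -
  note * = ex1_is_median[OF real_distribution_beta[OF assms] zero_less_one
      measure_beta_distribution[OF assms]]
  show iff: "is_median (beta_distribution a b) v \<longleftrightarrow> v = Med a b" for v
    unfolding Med_def median_def using *(1) by (metis theI')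
  from *(2)[of "Med a b"] show "0 < Med a b" "Med a b < 1" by (auto simp: iff)
qed

section \<open>The maximum of a power over a power of a quadratic\<close>

text \<open>
  Strict concavity of \<open>ln\<close> between \<open>1\<close> and \<open>s\<close>. It follows from \<open>ln y \<le> y - 1\<close>, with equality only at
  \<open>y = 1\<close>, applied at \<open>y = 1 / w\<close> and \<open>y = s / w\<close>, where \<open>w\<close> is the weighted mean: the two upper bounds
  cancel.
\<close>

lemma log_weighted_less:
  fixes \<alpha> \<beta> s :: real
  assumes "\<alpha> > 0" "\<beta> > 0" "\<alpha> + \<beta> = 1" "s > 0" "s \<noteq> 1"
  shows "\<beta> * ln s < ln (\<alpha> + \<beta> * s)"
proof -
  define w where "w = \<alpha> + \<beta> * s"
  have w: "w > 0" using assms by (simp add: w_def add_pos_pos)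
  have "w - 1 = \<beta> * (s - 1)" using assms(3) by (simp add: w_def algebra_simps)
  then have w1: "w \<noteq> 1" using assms by auto
  have "ln (1 / w) < 1 / w - 1"
    using w w1 ln_le_minus_one[of "1 / w"] ln_eq_minus_one[of "1 / w"] by fastforce
  then have "\<alpha> * ln (1 / w) < \<alpha> * (1 / w - 1)" using assms by simp
  moreover have "\<beta> * ln (s / w) \<le> \<beta> * (s / w - 1)"
    using assms w by (intro mult_left_mono ln_le_minus_one) auto
  ultimately have "\<alpha> * ln (1 / w) + \<beta> * ln (s / w) < \<alpha> * (1 / w - 1) + \<beta> * (s / w - 1)" by simp
  also have "\<dots> = (\<alpha> + \<beta> * s) / w - (\<alpha> + \<beta>)"
    by (simp add: algebra_simps add_divide_distrib)
  also have "\<dots> = 0" using w assms(3) by (simp add: w_def[symmetric])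
  finally have "\<beta> * ln s - (\<alpha> + \<beta>) * ln w < 0" using w assms(4) by (simp add: ln_div algebra_simps)
  then show ?thesis using assms(3) by (simp add: w_def)
qed


text \<open>
  Divided by their values at \<open>u0\<close>, the numerator is \<open>(u / u0) ^ p\<close> and the quadratic is a weighted mean
  of \<open>1\<close> and \<open>s = (u / u0)\<^sup>2\<close>. The value of \<open>u0\<close> is the one for which the weight of \<open>s\<close> is
  \<open>p / (2 * q)\<close>, and then the claim is \<open>log_weighted_less\<close> multiplied by \<open>q\<close>.
\<close>

lemma power_over_quadratic_less_max:
  fixes \<delta> \<kappa> u :: real and p q :: nat
  defines "u0 \<equiv> sqrt (real p * \<delta> / (\<kappa> * (2 * real q - real p)))"
  assumes pos: "\<delta> > 0" "\<kappa> > 0" and pq: "0 < p" "p < 2 * q" and u: "u > 0" "u \<noteq> u0"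
  shows "u ^ p / (\<delta> + \<kappa> * u\<^sup>2) ^ q < u0 ^ p / (\<delta> + \<kappa> * u0\<^sup>2) ^ q"
proof -
  define \<beta> where "\<beta> = real p / (2 * real q)"
  define s where "s = (u / u0)\<^sup>2"
  define w where "w = (\<delta> + \<kappa> * u\<^sup>2) / (\<delta> + \<kappa> * u0\<^sup>2)"
  have r: "2 * real q - real p > 0" using pq by linarith
  have u0: "u0 > 0" using pos pq r by (simp add: u0_def)
  have u0_sq: "u0\<^sup>2 = real p * \<delta> / (\<kappa> * (2 * real q - real p))"
    unfolding u0_def using pos r by simp
  have den: "\<delta> + \<kappa> * u0\<^sup>2 > 0" "\<delta> + \<kappa> * u\<^sup>2 > 0"
    using pos by (simp_all add: add_pos_nonneg)
  have "\<kappa> * u0\<^sup>2 = \<beta> * (\<delta> + \<kappa> * u0\<^sup>2)"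
    unfolding u0_sq \<beta>_def using pos r pq by (simp add: field_simps)
  then have \<beta>1: "\<kappa> * u0\<^sup>2 / (\<delta> + \<kappa> * u0\<^sup>2) = \<beta>" using den(1) by (simp add: field_simps)
  have "w = \<delta> / (\<delta> + \<kappa> * u0\<^sup>2) + \<kappa> * u0\<^sup>2 / (\<delta> + \<kappa> * u0\<^sup>2) * s"
    using u0 by (simp add: w_def s_def power_divide add_divide_distrib)
  also have "\<delta> / (\<delta> + \<kappa> * u0\<^sup>2) = 1 - \<kappa> * u0\<^sup>2 / (\<delta> + \<kappa> * u0\<^sup>2)"
    using den(1) by (simp add: field_simps)
  finally have w: "w = (1 - \<beta>) + \<beta> * s" by (simp only: \<beta>1)
  have s: "s > 0" "s \<noteq> 1"
  proof -
    have "u / u0 > 0" "u / u0 \<noteq> 1" using u u0 by auto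
    then show "s > 0" "s \<noteq> 1" unfolding s_def power2_eq_1_iff by (auto simp del: divide_eq_1_iff)
  qed
  have "0 < \<beta>" "\<beta> < 1" using pq by (auto simp: \<beta>_def field_simps)
  then have "\<beta> * ln s < ln w" unfolding w using s by (intro log_weighted_less) auto
  then have "real q * (\<beta> * ln s) < real q * ln w" using pq by simp
  moreover have "real q * (\<beta> * ln s) = real p * ln (u / u0)"
    using pq u u0 by (simp add: \<beta>_def s_def ln_realpow)
  moreover have "w > 0" using den by (simp add: w_def)
  ultimately have "ln ((u / u0) ^ p) < ln (w ^ q)" using u u0 by (simp add: ln_realpow)
  then have "(u / u0) ^ p < w ^ q" using u u0 \<open>w > 0\<close> by simp
  then show ?thesis using u0 den by (simp add: w_def power_divide field_simps)
qed

section \<open>The predictive distribution\<close>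

text \<open>
  \<open>C\<close> is the product of the observed lifetimes times the factor up to which a likelihood is determined.
\<close>

context
  fixes L :: "real \<Rightarrow> real" and d m k :: nat and C \<delta> :: real
  assumes C: "C > 0" and \<delta>: "\<delta> > 0" and d: "d \<ge> 1" and m: "m \<ge> 1" and k: "k \<ge> 1"
    and L: "\<And>\<sigma>. \<sigma> > 0 \<Longrightarrow> L \<sigma> = C / \<sigma> ^ d * exp (- (\<delta> / 2) / \<sigma>)"
begin

text \<open>
  The normalising constant \<open>N\<close> of the posterior is an inverse gamma integral with shape \<open>d\<close> and scale
  \<open>\<delta> / 2\<close>. The mixture over \<open>\<sigma>\<close> is another, with shape \<open>d + m\<close> and scale \<open>(\<delta> + k * u\<^sup>2) / 2\<close>. The three
  Gamma values combine to the Beta function.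
\<close>

lemma predictive_density_closed_form:
  assumes u: "u > 0"
  shows "predictive_density m k L u = 2 * real k ^ m * \<delta> ^ d / Beta (real d) (real m)
      * (u ^ (2 * m - 1) / (\<delta> + real k * u\<^sup>2) ^ (d + m))"
proof -
  define w where "w = \<delta> + real k * u\<^sup>2"
  have w: "w > 0" using \<delta> by (simp add: w_def add_pos_nonneg)
  define N where "N = (LINT s:{0<..}|lborel. L s * (1 / s))"
  have "N = (LINT s:{0<..}|lborel. C * (exp (- (\<delta> / 2) / s) / s ^ (d + 1)))"
    unfolding N_def by (intro set_lebesgue_integral_cong) (auto simp: L)
  also have "\<dots> = C * (Gamma (real d) / (\<delta> / 2) ^ d)"
    using \<delta> d by (simp only: set_integral_mult_right inverse_gamma_integral half_gt_zero)
  finally have N: "N = C * (Gamma (real d) / (\<delta> / 2) ^ d)" .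
  define K where "K = real k ^ m * u ^ (2 * m - 1) / (Gamma (real m) * 2 ^ (m - 1)) * (C / N)"
  have "predictive_density m k L u
      = (LINT s:{0<..}|lborel. repair_density m k s u * posterior_density L s)"
    using u by (simp add: predictive_density_def)
  also have "\<dots> = (LINT s:{0<..}|lborel. K * (exp (- (w / 2) / s) / s ^ (d + m + 1)))"
  proof (intro set_lebesgue_integral_cong allI impI)
    fix s :: real assume s: "s \<in> {0<..}"
    have "- (w / 2) / s = - (real k * u\<^sup>2) / (2 * s) + - (\<delta> / 2) / s"
      using s by (simp add: w_def field_simps)
    then have "exp (- (w / 2) / s) = exp (- (real k * u\<^sup>2) / (2 * s)) * exp (- (\<delta> / 2) / s)"
      by (simp only: exp_add)
    moreover have "posterior_density L s = C / s ^ d * exp (- (\<delta> / 2) / s) * (1 / s) / N"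
      using s by (simp only: posterior_density_def N_def L greaterThan_iff)
    ultimately show "repair_density m k s u * posterior_density L s
        = K * (exp (- (w / 2) / s) / s ^ (d + m + 1))"
      using s by (simp add: repair_density_def K_def power_add mult_ac)
  qed simp
  also have "\<dots> = K * (Gamma (real (d + m)) / (w / 2) ^ (d + m))"
    using w d by (subst set_integral_mult_right, subst inverse_gamma_integral) auto
  finally have eq: "predictive_density m k L u = K * (Gamma (real (d + m)) / (w / 2) ^ (d + m))" .
  obtain c where c: "m = Suc c" using m by (cases m) auto
  have G: "Gamma (real d) > 0" "Gamma (real m) > 0" "Gamma (real d + real m) > 0"
    using d m by (auto intro!: Gamma_real_pos)
  show ?thesis
    unfolding eq K_def N w_def[symmetric] Beta_def using G C \<delta> w
    by (simp add: c power_divide field_simps power_add)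
qed

lemma predictive_density_eq:
  "predictive_density m k L u = (if u > 0 then 2 * real k ^ m * \<delta> ^ d / Beta (real d) (real m)
      * (u ^ (2 * m - 1) / (\<delta> + real k * u\<^sup>2) ^ (d + m)) else 0)"
  using predictive_density_closed_form[of u] by (simp add: predictive_density_def)

text \<open>
  The map in this statement inverts \<open>t = \<delta> / (\<delta> + k * u\<^sup>2)\<close>, for which
  \<open>1 - t = k * u\<^sup>2 / (\<delta> + k * u\<^sup>2)\<close>; hence the Beta density in \<open>t\<close> times the Jacobian is the
  closed form of the predictive density.
\<close>

lemma predictive_distribution_eq_distr:
  "predictive_distribution m k L
    = distr (beta_distribution (real d) (real m)) borel (\<lambda>t. sqrt (\<delta> * (1 - t) / (real k * t)))"
  unfolding predictive_distribution_def beta_distribution_def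
proof (rule density_lborel_eq_distr)
  let ?g = "\<lambda>u. \<delta> / (\<delta> + real k * u\<^sup>2)"
  let ?g' = "\<lambda>u. - (2 * real k * u * \<delta>) / (\<delta> + real k * u\<^sup>2)\<^sup>2"
  have w: "\<delta> + real k * u\<^sup>2 > 0" for u using \<delta> by (simp add: add_pos_nonneg)
  have dm: "real d > 0" "real m > 0" using d m by auto
  show "{0::real<..} \<in> sets borel" by simp
  show "(?g has_field_derivative ?g' u) (at u within {0<..})" for u
    using w[of u] by (auto intro!: derivative_eq_intros simp: power2_eq_square)
  show "sqrt (\<delta> * (1 - ?g u) / (real k * ?g u)) = u" if "u \<in> {0<..}" for u
  proof -
    have "1 - ?g u = real k * u\<^sup>2 / (\<delta> + real k * u\<^sup>2)"
      using w[of u] by (simp add: field_simps)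
    then have "\<delta> * (1 - ?g u) / (real k * ?g u) = u\<^sup>2"
      using w[of u] \<delta> k by simp
    then show ?thesis using that by simp
  qed
  show "(\<lambda>t. sqrt (\<delta> * (1 - t) / (real k * t))) \<in> borel_measurable borel" by measurable
  show "integrable lborel (beta_density (real d) (real m))"
    using has_bochner_integral_beta_density[OF dm] by (simp add: has_bochner_integral_iff)
  show "0 \<le> beta_density (real d) (real m) t" for t by (rule beta_density_nonneg[OF dm])
  show "beta_density (real d) (real m) t = 0" if "t \<notin> ?g ` {0<..}" for t
  proof (rule ccontr)
    assume "beta_density (real d) (real m) t \<noteq> 0"
    then have t: "0 < t" "t < 1" by (auto simp: beta_density_def split: if_splits)
    let ?u = "sqrt (\<delta> * (1 - t) / (real k * t))"
    have "?u > 0" using t \<delta> k by simp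
    moreover have "t = ?g ?u" using t \<delta> k by (simp add: field_simps)
    ultimately show False using that by blast
  qed
  show "predictive_density m k L \<in> borel_measurable borel"
    unfolding predictive_density_eq[abs_def] by measurable
  show "predictive_density m k L u = \<bar>?g' u\<bar> * beta_density (real d) (real m) (?g u)"
    if "u \<in> {0<..}" for u
  proof -
    obtain c where c: "d = Suc c" using d by (cases d) auto
    obtain l where l: "m = Suc l" using m by (cases m) auto
    have u: "u > 0" using that by simp
    have g: "0 < ?g u" "?g u < 1" "1 - ?g u = real k * u\<^sup>2 / (\<delta> + real k * u\<^sup>2)"
      using w[of u] \<delta> u k by (auto simp: field_simps)
    define W where "W = \<delta> + real k * u\<^sup>2"
    have W: "W > 0" using w by (simp add: W_def)
    have "beta_density (real d) (real m) (?g u)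
        = ?g u ^ c * (1 - ?g u) ^ l / Beta (real d) (real m)"
      using g(1,2) by (simp add: beta_density_def c l powr_realpow)
    also have "\<dots> = (\<delta> / W) ^ c * (real k * u\<^sup>2 / W) ^ l / Beta (real d) (real m)"
      unfolding g(3) by (simp only: W_def)
    finally have beta: "beta_density (real d) (real m) (?g u)
        = (\<delta> / W) ^ c * (real k * u\<^sup>2 / W) ^ l / Beta (real d) (real m)" .
    have g': "\<bar>?g' u\<bar> = 2 * real k * u * \<delta> / W\<^sup>2"
      using u \<delta> W by (simp add: W_def[symmetric] abs_mult)
    have odd: "u ^ (2 * m - 1) = u * (u\<^sup>2) ^ l" by (simp add: l power_mult)
    have split: "W ^ (d + m) = W\<^sup>2 * (W ^ c * W ^ l)"
      by (simp add: c l power_add power2_eq_square)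
    have "predictive_density m k L u = 2 * real k ^ m * \<delta> ^ d / Beta (real d) (real m)
        * (u * (u\<^sup>2) ^ l / (W\<^sup>2 * (W ^ c * W ^ l)))"
      using u by (simp only: predictive_density_eq if_True odd split W_def[symmetric])
    also have "\<dots> = 2 * real k * u * \<delta> / W\<^sup>2
        * ((\<delta> / W) ^ c * (real k * u\<^sup>2 / W) ^ l / Beta (real d) (real m))"
      by (simp only: c l power_Suc power_divide power_mult_distrib times_divide_times_eq
          times_divide_eq_left times_divide_eq_right divide_divide_eq_left divide_divide_eq_right mult_ac)
    finally show ?thesis by (simp only: beta g')
  qed
  show "predictive_density m k L u = 0" if "u \<notin> {0<..}" for u
    using that by (simp add: predictive_density_def)
qed

text \<open>
  In the expectation of \<open>sqrt (\<delta> * (1 - t) / (k * t))\<close> the factor \<open>sqrt ((1 - t) / t)\<close> lowers the first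
  parameter of the Beta integral by \<open>1/2\<close> and raises the second by \<open>1/2\<close>. Convergence at \<open>t = 0\<close> needs
  \<open>d > 1/2\<close>, which \<open>d \<ge> 1\<close> provides.
\<close>

lemma predictive_mean:
  "has_bochner_integral (predictive_distribution m k L) (\<lambda>u. u)
     (Beta (real d - 1 / 2) (real m + 1 / 2) / Beta (real d) (real m) * sqrt (\<delta> / real k))"
  unfolding predictive_distribution_eq_distr beta_distribution_def
proof (intro has_bochner_integral_distr has_bochner_integral_density)
  have dm: "real d > 0" "real m > 0" using d m by auto
  define c where "c = sqrt (\<delta> / real k) / Beta (real d) (real m)"
  have "has_bochner_integral lborel (\<lambda>t. c * (indicator {0<..<1} t *
      (t powr (real d - 1 / 2 - 1) * (1 - t) powr (real m + 1 / 2 - 1))))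
      (c * Beta (real d - 1 / 2) (real m + 1 / 2))"
    using d by (intro has_bochner_integral_mult_right has_bochner_integral_Beta) auto
  also have "(\<lambda>t. c * (indicator {0<..<1} t *
      (t powr (real d - 1 / 2 - 1) * (1 - t) powr (real m + 1 / 2 - 1))))
    = (\<lambda>t. beta_density (real d) (real m) t *\<^sub>R sqrt (\<delta> * (1 - t) / (real k * t)))"
  proof
    fix t :: real
    show "c * (indicator {0<..<1} t *
      (t powr (real d - 1 / 2 - 1) * (1 - t) powr (real m + 1 / 2 - 1)))
      = beta_density (real d) (real m) t *\<^sub>R sqrt (\<delta> * (1 - t) / (real k * t))"
    proof (cases "0 < t \<and> t < 1")
      case True
      have "t powr (real d - 1 / 2 - 1) = t powr (real d - 1) / sqrt t"
        using True powr_diff[of t "real d - 1" "1 / 2"] by (simp add: powr_half_sqrt algebra_simps)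
      moreover have "(1 - t) powr (real m + 1 / 2 - 1) = (1 - t) powr (real m - 1) * sqrt (1 - t)"
        using True powr_add[of "1 - t" "real m - 1" "1 / 2"]
        by (simp add: powr_half_sqrt algebra_simps)
      ultimately show ?thesis
        using True by (simp add: beta_density_def c_def real_sqrt_divide real_sqrt_mult mult_ac)
    qed (auto simp: beta_density_def)
  qed
  finally show "has_bochner_integral lborel
      (\<lambda>t. beta_density (real d) (real m) t *\<^sub>R sqrt (\<delta> * (1 - t) / (real k * t)))
      (Beta (real d - 1 / 2) (real m + 1 / 2) / Beta (real d) (real m) * sqrt (\<delta> / real k))"
    by (simp add: c_def mult.commute)
  show "AE t in lborel. 0 \<le> beta_density (real d) (real m) t"
    by (simp add: beta_density_nonneg[OF dm])
qed measurable

text \<open>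
  The map from \<open>t\<close> to \<open>u\<close> is decreasing on the open unit interval, which carries all the mass of the
  Beta distribution. So the lower tail at a positive \<open>v\<close> has the mass of a Beta upper tail, and
  conversely, whence \<open>v\<close> is a median exactly if its preimage is one. At a nonpositive \<open>v\<close> the lower tail
  has mass \<open>0\<close>.
\<close>

lemma predictive_median:
  "is_median (predictive_distribution m k L) v \<longleftrightarrow>
    v = sqrt ((1 - Med (real d) (real m)) * \<delta> / (real k * Med (real d) (real m)))"
proof -
  have dm: "real d > 0" "real m > 0" using d m by auto
  let ?M = "beta_distribution (real d) (real m)"
  let ?h = "\<lambda>t. sqrt (\<delta> * (1 - t) / (real k * t))"
  interpret real_distribution ?M by (rule real_distribution_beta[OF dm])
  have AE01: "AE t in ?M. 0 < t \<and> t < 1"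
    unfolding beta_distribution_def by (subst AE_density) (auto simp: beta_density_def)
  have h [measurable]: "?h \<in> borel_measurable borel" by measurable
  have pre: "measure (predictive_distribution m k L) A = measure ?M B"
    if [measurable]: "A \<in> sets borel" "B \<in> sets borel"
      and "\<And>t. 0 < t \<Longrightarrow> t < 1 \<Longrightarrow> ?h t \<in> A \<longleftrightarrow> t \<in> B" for A B
  proof -
    have "measure (predictive_distribution m k L) A = measure ?M (?h -` A \<inter> space ?M)"
      unfolding predictive_distribution_eq_distr by (rule measure_distr) auto
    also have "\<dots> = measure ?M B"
    proof (rule measure_eq_AE)
      show "AE t in ?M. t \<in> ?h -` A \<inter> space ?M \<longleftrightarrow> t \<in> B"
        using AE01 by eventually_elim (use that in auto)
    qed measurable
    finally show ?thesis .
  qed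
  show ?thesis
  proof (cases "v > 0")
    case False
    have "measure (predictive_distribution m k L) {..v} = measure ?M {}"
    proof (rule pre)
      fix t :: real assume "0 < t" "t < 1"
      then have "?h t > 0" using \<delta> k by simp
      then have "\<not> ?h t \<le> v" using False by linarith
      then show "?h t \<in> {..v} \<longleftrightarrow> t \<in> {}" by (simp only: atMost_iff empty_iff)
    qed auto
    then have "\<not> is_median (predictive_distribution m k L) v" by (simp add: is_median_def)
    moreover have "(1 - Med (real d) (real m)) * \<delta> / (real k * Med (real d) (real m)) > 0"
      using \<delta> k is_median_beta_iff(2,3)[OF dm] by simp
    ultimately show ?thesis using False by auto
  next
    case True
    let ?t = "\<delta> / (\<delta> + real k * v\<^sup>2)"
    have w: "\<delta> + real k * v\<^sup>2 > 0" using \<delta> by (simp add: add_pos_nonneg)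
    have le: "?h t \<le> v \<longleftrightarrow> ?t \<le> t" and ge: "v \<le> ?h t \<longleftrightarrow> t \<le> ?t" if "0 < t" "t < 1" for t
    proof -
      have "?h t \<le> v \<longleftrightarrow> \<delta> * (1 - t) / (real k * t) \<le> v\<^sup>2"
        using True real_sqrt_le_iff[of "\<delta> * (1 - t) / (real k * t)" "v\<^sup>2"]
        by (simp only: real_sqrt_abs abs_of_pos)
      also have "\<dots> \<longleftrightarrow> ?t \<le> t"
        using that w k by (simp add: field_simps)
      finally show "?h t \<le> v \<longleftrightarrow> ?t \<le> t" .
      have "v \<le> ?h t \<longleftrightarrow> v\<^sup>2 \<le> \<delta> * (1 - t) / (real k * t)"
        using True real_sqrt_le_iff[of "v\<^sup>2" "\<delta> * (1 - t) / (real k * t)"]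
        by (simp only: real_sqrt_abs abs_of_pos)
      also have "\<dots> \<longleftrightarrow> t \<le> ?t"
        using that w k by (simp add: field_simps)
      finally show "v \<le> ?h t \<longleftrightarrow> t \<le> ?t" .
    qed
    have "measure (predictive_distribution m k L) {..v} = measure ?M {?t..}"
      by (rule pre) (auto simp: le)
    moreover have "measure (predictive_distribution m k L) {v..} = measure ?M {..?t}"
      by (rule pre) (auto simp: ge)
    ultimately have "is_median (predictive_distribution m k L) v \<longleftrightarrow> is_median ?M ?t"
      by (auto simp: is_median_def)
    also have "\<dots> \<longleftrightarrow> ?t = Med (real d) (real m)" by (rule is_median_beta_iff(1)[OF dm])
    also have "\<dots> \<longleftrightarrow> v = ?h (Med (real d) (real m))"
      using le[OF is_median_beta_iff(2,3)[OF dm]] ge[OF is_median_beta_iff(2,3)[OF dm]]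
      by (auto simp: order.eq_iff)
    finally show ?thesis by (simp add: mult.commute)
  qed
qed

text \<open>
  The maximum of \<open>u ^ p / (\<delta> + k * u\<^sup>2) ^ q\<close> for \<open>p = 2 * m - 1\<close> and \<open>q = d + m\<close>; here
  \<open>2 * q - p = 2 * d + 1\<close>.
\<close>

lemma predictive_mode:
  "is_arg_max (predictive_density m k L) (\<lambda>u. u > 0) u \<longleftrightarrow>
    u = sqrt ((2 * real m - 1) * \<delta> / (real k * (2 * real d + 1)))" (is "_ \<longleftrightarrow> u = ?u0")
proof -
  have eq: "?u0 = sqrt (real (2 * m - 1) * \<delta> / (real k * (2 * real (d + m) - real (2 * m - 1))))"
  proof -
    have "real (2 * m - 1) = 2 * real m - 1" using m by (simp add: of_nat_diff)
    moreover from this have "2 * real (d + m) - real (2 * m - 1) = 2 * real d + 1" by simp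
    ultimately show ?thesis by (simp only:)
  qed
  have "(2 * real m - 1) * \<delta> > 0" using m \<delta> by simp
  then have u0: "?u0 > 0" using k by simp
  have pq: "0 < 2 * m - 1" "2 * m - 1 < 2 * (d + m)" using m by auto
  have "real k > 0" using k by simp
  note max = power_over_quadratic_less_max[OF \<delta> this pq, folded eq]
  have c: "2 * real k ^ m * \<delta> ^ d / Beta (real d) (real m) > 0"
    using d m k \<delta> by (simp add: Beta_pos_real)
  have less: "predictive_density m k L v < predictive_density m k L ?u0"
    if v: "v > 0" "v \<noteq> ?u0" for v
    unfolding predictive_density_eq if_P[OF u0] if_P[OF v(1)]
    by (rule mult_strict_left_mono[OF max[OF v] c])
  show ?thesis
    unfolding is_arg_max_def using less u0 by (metis less_asym)
qed

end

theorem mainTheorem4: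
  fixes n r d m k :: nat and T T0 :: real and x :: "nat \<Rightarrow> real" and L :: "real \<Rightarrow> real"
  assumes r: "1 \<le> r" "r \<le> n"
    and T: "T > 0"
    and x_pos: "0 < x 1"
    and x_ordered: "strict_mono_on {1..n} x"
    and d: "d = observed_failures r T x"
    and d_ge_1: "d \<ge> 1"
    and T0: "T0 = termination_time r T x"
    and L: "is_likelihood n d T0 x L"
    and m: "m \<ge> 1"
    and k: "k \<ge> 1"
  shows
    "has_bochner_integral (predictive_distribution m k L) (\<lambda>u. u)
       (Beta (real d - 1 / 2) (real m + 1 / 2) / Beta (real d) (real m)
          * sqrt (delta n d T0 x / real k)) \<and>
     (\<forall>v. is_median (predictive_distribution m k L) v \<longleftrightarrow>
        v = sqrt ((1 - Med (real d) (real m)) * delta n d T0 x / (real k * Med (real d) (real m)))) \<and>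
     (\<forall>u. is_arg_max (predictive_density m k L) (\<lambda>u. u > 0) u \<longleftrightarrow>
        u = sqrt ((2 * real m - 1) * delta n d T0 x / (real k * (2 * real d + 1))))"
proof -
  have "finite {s. 1 \<le> s \<and> s \<le> r \<and> x s \<le> T}"
    by (rule finite_subset[of _ "{..r}"]) auto
  then have "d \<in> insert 0 {s. 1 \<le> s \<and> s \<le> r \<and> x s \<le> T}"
    unfolding d observed_failures_def
    by (intro Max_in) auto
  then have "d \<le> n" using r by auto
  have x: "x i > 0" if "1 \<le> i" "i \<le> d" for i
    using that x_pos strict_mono_onD[OF x_ordered, of 1 i] \<open>d \<le> n\<close> by (cases "i = 1") auto
  define \<delta> where "\<delta> = delta n d T0 x"
  have "(\<Sum>i=1..d. (x i)\<^sup>2) > 0" using d_ge_1 x by (intro sum_pos) force+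
  then have \<delta>: "\<delta> > 0"
    using \<open>d \<le> n\<close> by (simp add: \<delta>_def delta_def add_pos_nonneg)
  from L obtain c where c: "c > 0" "\<And>\<sigma>. \<sigma> > 0 \<Longrightarrow> L \<sigma> = c * likelihood_kernel n d T0 x \<sigma>"
    by (auto simp: is_likelihood_def)
  have "c * (\<Prod>i=1..d. x i) > 0" using c(1) x by (intro mult_pos_pos prod_pos) auto
  moreover have "L \<sigma> = c * (\<Prod>i=1..d. x i) / \<sigma> ^ d * exp (- (\<delta> / 2) / \<sigma>)"
    if "\<sigma> > 0" for \<sigma>
    using c(2)[OF that] by (simp add: likelihood_kernel_def \<delta>_def delta_def)
  ultimately show ?thesis
    unfolding \<delta>_def[symmetric]
    using predictive_mean[OF _ \<delta> d_ge_1 m k] predictive_median[OF _ \<delta> d_ge_1 m k]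
      predictive_mode[OF _ \<delta> d_ge_1 m k]
    by blast
qed

end
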